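(* Assume that $M$ is integrable and that $$\int_\Omega L(\omega)\,P(d\omega)<1.$$ If $$\int_{\mathbb R}g(t)\Phi(t)\,dt=\widehat{g}(0)$$ and $G$ is Lipschitzian, then there exists a Lipschitzian function $F\colon\mathbb R\to\mathbb R$ satisfying $$F(x)=\int_{\Omega}F(L(\omega)x-M(\omega))\,P(d\omega)+G(x)\quad\text{for every }x\in\mathbb R.$$ Moreover, if for such an $F$ there exists $f\in L^1(\mathbb R)$ such that $F(x)=\int_{-\infty}^x f(t)\,dt$ for every $x\in\mathbb R$, then $f\in V_g$.
   Context: Let $(\Omega,\mathcal A,P)$ be a complete probability space, $L,M\colon\Omega\to\mathbb R$ random variables with $L>0$ almost everywhere on $\Omega$, and $g\in L^1(\mathbb R)$ a nontrivial (nonzero) function. $V_g$ denotes the set of all $f\in L^1(\mathbb R)$ such that $$f(x)=\int_{\Omega}|L(\omega)|f(L(\omega)x-M(\omega))\,P(d\omega)+g(x)$$ for Lebesgue-almost all $x\in\mathbb R$ (this does not depend on the representative of $f$). The function $G\colon\mathbb R\to\mathbb R$ is defined by $G(x)=\int_{-\infty}^x g(t)\,dt$. The Fourier transform is $\widehat g(x)=\int_{\mathbb R}\exp\{itx\}g(t)\,dt$, so $\widehat g(0)=\int_{\mathbb R}g(t)\,dt$. $(\Omega^\infty,P^\infty)$ is the countable product of copies of $(\Omega,\mathcal A,P)$. Put $\varphi(x,\omega)=L(\omega)x-M(\omega)$ and define the iterates, for $x\in\mathbb R$ and $\varpi=(\omega_1,\omega_2,\dots)\in\Omega^\infty$, by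 $$\varphi^1(x,\varpi)=\varphi(x,\omega_1),\qquad \varphi^{n+1}(x,\varpi)=\varphi(\varphi^n(x,\varpi),\omega_{n+1}).$$ When $M$ is integrable and $\int_\Omega L\,dP<1$, for every $x\in\mathbb R$ the sequence of random variables $(\varphi^n(x,\cdot))_{n\in\mathbb N}$ on $\Omega^\infty$ converges in distribution to a random variable $\phi$ whose law does not depend on $x$. $\Phi$ denotes the probability distribution function of $\phi$, i.e. $\Phi(t)=\mathrm{Prob}(\phi\le t)$. *)

theory Defs
  imports "HOL-Probability.Probability"
begin

definition phi_map :: "('a \<Rightarrow> real) \<Rightarrow> ('a \<Rightarrow> real) \<Rightarrow> real \<Rightarrow> 'a \<Rightarrow> real" where
  "phi_map L M x \<omega> = L \<omega> * x - M \<omega>"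

text \<open>Sequences in \<open>\<Omega>\<^sup>\<infinity>\<close> are indexed from \<open>0\<close>, so \<open>w n\<close> is the coordinate \<open>\<omega>\<^sub>n\<^sub>+\<^sub>1\<close>;
  the additional iterate of order \<open>0\<close> is the identity.\<close>

primrec phi_iter :: "('a \<Rightarrow> real) \<Rightarrow> ('a \<Rightarrow> real) \<Rightarrow> nat \<Rightarrow> real \<Rightarrow> (nat \<Rightarrow> 'a) \<Rightarrow> real" where
  "phi_iter L M 0 x w = x"
| "phi_iter L M (Suc n) x w = phi_map L M (phi_iter L M n x w) (w n)"

definition iter_law ::
    "'a measure \<Rightarrow> ('a \<Rightarrow> real) \<Rightarrow> ('a \<Rightarrow> real) \<Rightarrow> nat \<Rightarrow> real \<Rightarrow> real measure" where
  "iter_law P L M n x = distr (PiM (UNIV :: nat set) (\<lambda>_. P)) borel (phi_iter L M n x)"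

text \<open>The law of the limit in distribution of the iterates, common to all starting points \<open>x\<close>.
  Weak limits of probability laws are unique; the limit exists whenever \<open>M\<close> is integrable and
  \<open>L\<close> is almost everywhere positive with integral less than \<open>1\<close>.\<close>

definition limit_law :: "'a measure \<Rightarrow> ('a \<Rightarrow> real) \<Rightarrow> ('a \<Rightarrow> real) \<Rightarrow> real measure" where
  "limit_law P L M =
     (THE \<mu>. real_distribution \<mu> \<and> (\<forall>x. weak_conv_m (\<lambda>n. iter_law P L M n x) \<mu>))"

definition Phi :: "'a measure \<Rightarrow> ('a \<Rightarrow> real) \<Rightarrow> ('a \<Rightarrow> real) \<Rightarrow> real \<Rightarrow> real" where
  "Phi P L M = cdf (limit_law P L M)"

definition primitive :: "(real \<Rightarrow> real) \<Rightarrow> real \<Rightarrow> real" where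
  "primitive g x = (LINT t:{..x}|lebesgue. g t)"

definition fourier :: "(real \<Rightarrow> real) \<Rightarrow> real \<Rightarrow> complex" where
  "fourier g x = (LINT t|lebesgue. exp (\<i> * complex_of_real (t * x)) * complex_of_real (g t))"

definition lipschitzian :: "(real \<Rightarrow> real) \<Rightarrow> bool" where
  "lipschitzian F \<longleftrightarrow> (\<exists>C. C-lipschitz_on UNIV F)"

text \<open>Elements of \<open>L\<^sup>1(\<real>)\<close> are represented by Lebesgue integrable functions. As the Bochner
  integral of a non-integrable function is \<open>0\<close> by convention, existence of the integrals
  in the two equations below is required explicitly.\<close>

definition V :: "'a measure \<Rightarrow> ('a \<Rightarrow> real) \<Rightarrow> ('a \<Rightarrow> real) \<Rightarrow> (real \<Rightarrow> real) \<Rightarrow> (real \<Rightarrow> real) set" where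
  "V P L M g = {f. integrable lebesgue f \<and>
     (AE x in lebesgue.
        integrable P (\<lambda>\<omega>. \<bar>L \<omega>\<bar> * f (L \<omega> * x - M \<omega>)) \<and>
        f x = (LINT \<omega>|P. \<bar>L \<omega>\<bar> * f (L \<omega> * x - M \<omega>)) + g x)}"

definition integrated_eq ::
    "'a measure \<Rightarrow> ('a \<Rightarrow> real) \<Rightarrow> ('a \<Rightarrow> real) \<Rightarrow> (real \<Rightarrow> real) \<Rightarrow> (real \<Rightarrow> real) \<Rightarrow> bool" where
  "integrated_eq P L M G F \<longleftrightarrow>
     (\<forall>x. integrable P (\<lambda>\<omega>. F (L \<omega> * x - M \<omega>)) \<and>
          F x = (LINT \<omega>|P. F (L \<omega> * x - M \<omega>)) + G x)"

end

theory Submission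
  imports Defs
begin

text \<open>
  Write \<open>T h x\<close> for the mean of \<open>h (L x - M)\<close>, so that the functional equation reads
  \<open>F = T F + G\<close>: a Poisson equation for the Markov chain of the iterates, whose formal solution is
  the Neumann series of \<open>T\<close> applied to \<open>G\<close>.

  Two random affine maps with the same \<open>\<omega>\<close> bring points together by the factor \<open>L \<omega>\<close>, hence by the
  factor \<open>a = E L < 1\<close> in the mean. Therefore \<open>T\<close> shrinks Lipschitz constants by the factor \<open>a\<close>, and for a
  \<open>C\<close>-Lipschitz \<open>h\<close> the values \<open>T\<^sup>n h x\<close> form a Cauchy sequence with geometric rate, since one more
  step costs at most \<open>a\<^sup>n C E \<bar>L x - M - x\<bar>\<close> (\<open>mean_op_funpow_dist\<close>). The limit does not depend
  on \<open>x\<close>. As \<open>T\<^sup>n h x\<close> is the integral of \<open>h\<close> against the law of the \<open>n\<close>-th iterate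
  (\<open>integral_iter_law\<close>), this one estimate gives everything about the iterates: truncated absolute
  values as \<open>h\<close> give tightness, characters \<open>exp (i t x)\<close> as \<open>h\<close> give convergence of the
  characteristic functions, and together, by the theorems of Helly and Levy, the common weak limit
  \<open>\<mu>\<close> of the laws exists (\<open>limit_law\<close>). For bounded Lipschitz \<open>h\<close> the limit of \<open>T\<^sup>n h x\<close> is the
  \<open>\<mu>\<close>-integral of \<open>h\<close>, again with geometric rate. So the Neumann series converges, to a Lipschitz
  solution, as soon as \<open>G\<close> has \<open>\<mu>\<close>-integral \<open>0\<close> (\<open>poisson_equation\<close>).

  The hypothesis on \<open>g\<close> is this centering condition. By Fubini, integrating
  \<open>G(x) = \<integral> 1\<^bsub>t < x\<^esub> g(t) dt\<close> against \<open>\<mu>\<close> gives \<open>\<integral> g(t) (1 - \<Phi>(t)) dt\<close>, the difference of the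
  two sides of the hypothesis (\<open>integral_primitive\<close>).

  For the second claim, the substitution \<open>s = L t - M\<close> and Fubini turn the equation for the primitive
  \<open>F\<close> of \<open>f\<close> into the statement that \<open>f - E (L f (L t - M)) - g\<close> has vanishing primitive, and an
  integrable function with vanishing primitive is null (\<open>derivative_in_V\<close>). Fubini needs joint
  measurability, which a Borel representative of \<open>f\<close> provides; the return to \<open>f\<close> itself uses
  that \<open>P\<close> is complete.
\<close>

section \<open>Lipschitz functions and Bochner integrals\<close>

lemma lipschitz_measurable:
  fixes h :: "real \<Rightarrow> 'b::{banach, second_countable_topology}"
  assumes "C-lipschitz_on UNIV h"
  shows "h \<in> borel_measurable borel"
  using lipschitz_on_continuous_on[OF assms] by (rule borel_measurable_continuous_onI)

lemma iexp_lipschitz: "\<bar>t\<bar>-lipschitz_on UNIV (\<lambda>x. iexp (t * x))"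
proof (rule lipschitz_onI)
  fix x y :: real
  have "iexp (t * x) - iexp (t * y) = iexp (t * y) * (iexp (t * (x - y)) - 1)"
    by (simp add: algebra_simps flip: exp_add)
  then have "cmod (iexp (t * x) - iexp (t * y)) = cmod (iexp (t * (x - y)) - 1)"
    by (simp add: norm_mult)
  also have "\<dots> \<le> \<bar>t * (x - y)\<bar>"
    using iexp_approx1[of "t * (x - y)" 0] by simp
  finally show "dist (iexp (t * x)) (iexp (t * y)) \<le> \<bar>t\<bar> * dist x y"
    by (simp add: dist_norm abs_mult)
qed simp

lemma integral_norm_le_integral:
  fixes f :: "'a \<Rightarrow> 'b::{banach, second_countable_topology}"
  assumes "integrable N f" "integrable N k" "\<And>x. norm (f x) \<le> k x"
  shows "norm (LINT x|N. f x) \<le> (LINT x|N. k x)"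
  using assms by (intro order_trans[OF integral_norm_bound] integral_mono) auto

section \<open>Random affine maps that contract in the mean\<close>

locale mean_contraction = prob_space P for P :: "'a measure" +
  fixes L M :: "'a \<Rightarrow> real"
  assumes L_measurable [measurable]: "L \<in> borel_measurable P"
    and M_measurable [measurable]: "M \<in> borel_measurable P"
    and L_pos: "AE \<omega> in P. L \<omega> > 0"
    and L_integrable: "integrable P L"
    and M_integrable: "integrable P M"
    and L_mean_less_1: "(LINT \<omega>|P. L \<omega>) < 1"
begin

definition rate :: real where "rate = (LINT \<omega>|P. L \<omega>)"

definition displacement :: "real \<Rightarrow> real" where
  "displacement x = (LINT \<omega>|P. \<bar>phi_map L M x \<omega> - x\<bar>)"

text \<open>The transition operator \<open>T\<close> of the Markov chain of iterates; its contraction factor \<open>a\<close> on Lipschitz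
  constants is the constant \<open>rate\<close>. It acts on vector-valued functions because
  it is applied to real test functions as well as to complex characters.\<close>

definition mean_op :: "(real \<Rightarrow> 'b) \<Rightarrow> real \<Rightarrow> 'b::{banach, second_countable_topology}" where
  "mean_op h x = (LINT \<omega>|P. h (phi_map L M x \<omega>))"

lemma rate_nonneg: "0 \<le> rate"
  unfolding rate_def using L_pos by (intro integral_nonneg_AE) auto

lemma rate_less_1: "rate < 1"
  unfolding rate_def by (rule L_mean_less_1)

lemma sum_rate_le:
  assumes "0 \<le> c"
  shows "(\<Sum>k<n. rate ^ k * c) \<le> c / (1 - rate)"
proof -
  have "(\<Sum>k<n. rate ^ k) \<le> 1 / (1 - rate)"
    using rate_less_1 rate_nonneg by (simp add: sum_gp_strict divide_right_mono)
  from mult_left_mono[OF this assms] show ?thesis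
    by (simp add: sum_distrib_left mult.commute)
qed

lemma phi_map_integrable: "integrable P (phi_map L M x)"
  unfolding phi_map_def using L_integrable M_integrable by auto

lemma displacement_nonneg: "0 \<le> displacement x"
  unfolding displacement_def by simp

lemma mean_distance: "(LINT \<omega>|P. \<bar>phi_map L M x \<omega> - phi_map L M y \<omega>\<bar>) = rate * \<bar>x - y\<bar>"
proof -
  have "(LINT \<omega>|P. \<bar>phi_map L M x \<omega> - phi_map L M y \<omega>\<bar>) = (LINT \<omega>|P. L \<omega> * \<bar>x - y\<bar>)"
  proof (rule integral_cong_AE)
    show "AE \<omega> in P. \<bar>phi_map L M x \<omega> - phi_map L M y \<omega>\<bar> = L \<omega> * \<bar>x - y\<bar>"
      using L_pos
    proof eventually_elim
      case (elim \<omega>)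
      then show ?case by (simp add: phi_map_def abs_mult flip: right_diff_distrib)
    qed
  qed (auto simp: phi_map_def)
  then show ?thesis by (simp add: rate_def)
qed

lemma lipschitz_comp_integrable:
  fixes h :: "real \<Rightarrow> 'b::{banach, second_countable_topology}"
  assumes h: "C-lipschitz_on UNIV h"
  shows "integrable P (\<lambda>\<omega>. h (phi_map L M x \<omega>))"
proof (rule Bochner_Integration.integrable_bound)
  note [measurable] = lipschitz_measurable[OF h]
  show "integrable P (\<lambda>\<omega>. norm (h 0) + C * \<bar>phi_map L M x \<omega>\<bar>)"
    using phi_map_integrable by auto
  show "(\<lambda>\<omega>. h (phi_map L M x \<omega>)) \<in> borel_measurable P"
    unfolding phi_map_def by measurable
  show "AE \<omega> in P. norm (h (phi_map L M x \<omega>)) \<le> norm (norm (h 0) + C * \<bar>phi_map L M x \<omega>\<bar>)"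
  proof (rule AE_I2)
    fix \<omega>
    have "norm (h (phi_map L M x \<omega>)) \<le> norm (h 0) + norm (h (phi_map L M x \<omega>) - h 0)"
      by (metis add.commute norm_triangle_sub)
    also have "norm (h (phi_map L M x \<omega>) - h 0) \<le> C * \<bar>phi_map L M x \<omega>\<bar>"
      using lipschitz_onD[OF h, of "phi_map L M x \<omega>" 0] by (simp add: dist_norm)
    finally show "norm (h (phi_map L M x \<omega>)) \<le> norm (norm (h 0) + C * \<bar>phi_map L M x \<omega>\<bar>)"
      by simp
  qed
qed

lemma mean_op_lipschitz:
  fixes h :: "real \<Rightarrow> 'b::{banach, second_countable_topology}"
  assumes h: "C-lipschitz_on UNIV h"
  shows "(rate * C)-lipschitz_on UNIV (mean_op h)"
proof (rule lipschitz_onI)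
  fix x y
  have "norm (mean_op h x - mean_op h y)
      = norm (LINT \<omega>|P. h (phi_map L M x \<omega>) - h (phi_map L M y \<omega>))"
    using lipschitz_comp_integrable[OF h] by (simp add: mean_op_def)
  also have "\<dots> \<le> (LINT \<omega>|P. C * \<bar>phi_map L M x \<omega> - phi_map L M y \<omega>\<bar>)"
    using lipschitz_onD[OF h, of "phi_map L M x _" "phi_map L M y _"]
    by (intro integral_norm_le_integral) (auto simp: dist_norm lipschitz_comp_integrable[OF h] phi_map_integrable)
  also have "\<dots> = rate * C * dist x y"
    by (simp add: mean_distance dist_real_def)
  finally show "dist (mean_op h x) (mean_op h y) \<le> rate * C * dist x y"
    by (simp add: dist_norm)
qed (simp add: rate_nonneg lipschitz_on_nonneg[OF h])

text \<open>The displacement \<open>E \<bar>L x - M - x\<bar>\<close> is finite by integrability of \<open>L\<close> and \<open>M\<close>; it plays the role of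
  the distance between a point and its image in the proof of the contraction principle.\<close>

lemma mean_op_displacement:
  fixes h :: "real \<Rightarrow> 'b::{banach, second_countable_topology}"
  assumes h: "C-lipschitz_on UNIV h"
  shows "norm (mean_op h x - h x) \<le> C * displacement x"
proof -
  have "norm (mean_op h x - h x) = norm (LINT \<omega>|P. h (phi_map L M x \<omega>) - h x)"
    using lipschitz_comp_integrable[OF h] by (simp add: mean_op_def prob_space)
  also have "\<dots> \<le> (LINT \<omega>|P. C * \<bar>phi_map L M x \<omega> - x\<bar>)"
    using lipschitz_onD[OF h, of "phi_map L M x _" x]
    by (intro integral_norm_le_integral) (auto simp: dist_norm lipschitz_comp_integrable[OF h] phi_map_integrable)
  finally show ?thesis by (simp add: displacement_def)
qed

lemma mean_op_funpow_lipschitz: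
  fixes h :: "real \<Rightarrow> 'b::{banach, second_countable_topology}"
  assumes h: "C-lipschitz_on UNIV h"
  shows "(rate ^ n * C)-lipschitz_on UNIV ((mean_op ^^ n) h)"
proof (induction n)
  case (Suc n)
  show ?case using mean_op_lipschitz[OF Suc.IH] by (simp add: mult.assoc)
qed (simp add: h)

text \<open>Telescoping: the step from \<open>n + k\<close> to \<open>n + k + 1\<close> costs the Lipschitz constant \<open>a\<^sup>n\<^sup>+\<^sup>k C\<close> times the
  displacement of \<open>x\<close>, and these costs form a geometric series. The case \<open>n = 0\<close> bounds all
  \<open>T\<^sup>m h\<close> uniformly in \<open>m\<close>, which is what tightness needs.\<close>

lemma mean_op_funpow_dist:
  fixes h :: "real \<Rightarrow> 'b::{banach, second_countable_topology}"
  assumes h: "C-lipschitz_on UNIV h"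
  shows "norm ((mean_op ^^ (n + m)) h x - (mean_op ^^ n) h x)
    \<le> rate ^ n * (C * displacement x / (1 - rate))"
proof -
  have C: "0 \<le> C" by (rule lipschitz_on_nonneg[OF h])
  define c where "c = C * displacement x"
  have c: "0 \<le> c" by (simp add: c_def C displacement_nonneg)
  have "norm ((mean_op ^^ (n + m)) h x - (mean_op ^^ n) h x) \<le> (\<Sum>k<m. rate ^ (n + k) * c)"
  proof (induction m)
    case (Suc m)
    have "norm ((mean_op ^^ (n + Suc m)) h x - (mean_op ^^ n) h x)
      \<le> norm ((mean_op ^^ (n + Suc m)) h x - (mean_op ^^ (n + m)) h x)
        + norm ((mean_op ^^ (n + m)) h x - (mean_op ^^ n) h x)"
      by (rule order_trans[OF _ norm_triangle_ineq]) simp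
    also have "norm ((mean_op ^^ (n + Suc m)) h x - (mean_op ^^ (n + m)) h x) \<le> rate ^ (n + m) * c"
      using mean_op_displacement[OF mean_op_funpow_lipschitz[OF h, of "n + m"], of x]
      by (simp add: c_def mult.assoc)
    finally show ?case using Suc by simp
  qed simp
  also have "\<dots> = rate ^ n * (\<Sum>k<m. rate ^ k * c)"
    by (simp add: sum_distrib_left power_add mult_ac)
  also have "\<dots> \<le> rate ^ n * (c / (1 - rate))"
    using rate_nonneg by (intro mult_left_mono sum_rate_le c) auto
  finally show ?thesis by (simp add: c_def)
qed

text \<open>The values at one point are Cauchy, and the Lipschitz constants \<open>a\<^sup>n C\<close> tend to \<open>0\<close>, so the limit is
  the same at every point.\<close>

lemma mean_op_funpow_convergent:
  fixes h :: "real \<Rightarrow> 'b::{banach, second_countable_topology}"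
  assumes h: "C-lipschitz_on UNIV h"
  shows "\<exists>l. \<forall>x. (\<lambda>n. (mean_op ^^ n) h x) \<longlonglongrightarrow> l"
proof -
  have to0: "(\<lambda>n. rate ^ n * c) \<longlonglongrightarrow> 0" for c
    using rate_nonneg rate_less_1 by (intro tendsto_mult_left_zero LIMSEQ_power_zero) auto
  have "Cauchy (\<lambda>n. (mean_op ^^ n) h 0)"
  proof (rule CauchyI')
    fix e :: real assume "0 < e"
    with to0 have "\<forall>\<^sub>F n in sequentially. rate ^ n * (C * displacement 0 / (1 - rate)) < e"
      by (rule order_tendstoD)
    then obtain N where N: "\<And>n. n \<ge> N \<Longrightarrow> rate ^ n * (C * displacement 0 / (1 - rate)) < e"
      by (auto simp: eventually_sequentially)
    have "dist ((mean_op ^^ m) h 0) ((mean_op ^^ n) h 0) < e" if "m \<ge> N" "n > m" for m n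
      using mean_op_funpow_dist[OF h, of m "n - m" 0] N[OF that(1)] that
      by (simp add: dist_norm norm_minus_commute)
    then show "\<exists>N. \<forall>m\<ge>N. \<forall>n>m. dist ((mean_op ^^ m) h 0) ((mean_op ^^ n) h 0) < e"
      by blast
  qed
  then obtain l where l: "(\<lambda>n. (mean_op ^^ n) h 0) \<longlonglongrightarrow> l"
    using Cauchy_convergent convergent_def by blast
  have "(\<lambda>n. (mean_op ^^ n) h x) \<longlonglongrightarrow> l" for x
  proof (rule Lim_transform[OF l])
    show "(\<lambda>n. (mean_op ^^ n) h x - (mean_op ^^ n) h 0) \<longlonglongrightarrow> 0"
    proof (rule Lim_null_comparison)
      show "\<forall>\<^sub>F n in sequentially. norm ((mean_op ^^ n) h x - (mean_op ^^ n) h 0) \<le> rate ^ n * (C * \<bar>x\<bar>)"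
        using lipschitz_onD[OF mean_op_funpow_lipschitz[OF h], of x 0]
        by (simp add: dist_norm mult.assoc)
    qed (rule to0)
  qed
  then show ?thesis by blast
qed

lemma mean_op_funpow_limit_dist:
  fixes h :: "real \<Rightarrow> 'b::{banach, second_countable_topology}"
  assumes h: "C-lipschitz_on UNIV h" and l: "(\<lambda>n. (mean_op ^^ n) h x) \<longlonglongrightarrow> l"
  shows "norm (l - (mean_op ^^ n) h x) \<le> rate ^ n * (C * displacement x / (1 - rate))"
proof (rule tendsto_upperbound)
  show "(\<lambda>m. norm ((mean_op ^^ (n + m)) h x - (mean_op ^^ n) h x))
    \<longlonglongrightarrow> norm (l - (mean_op ^^ n) h x)"
    using LIMSEQ_ignore_initial_segment[OF l, of n]
    by (intro tendsto_intros) (simp add: add.commute)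
qed (use mean_op_funpow_dist[OF h] in auto)

section \<open>Laws of the iterates\<close>

sublocale seq: sequence_space P
  by unfold_locales

abbreviation S where "S \<equiv> PiM (UNIV :: nat set) (\<lambda>_. P)"

lemma phi_iter_pair_measurable [measurable]:
  "(\<lambda>z. phi_iter L M n (fst z) (snd z)) \<in> borel_measurable (borel \<Otimes>\<^sub>M S)"
  by (induction n) (auto simp: phi_map_def)

lemma phi_iter_measurable [measurable]: "phi_iter L M n x \<in> borel_measurable S"
  by (induction n) (auto simp: phi_map_def)

text \<open>The iterates are defined by adding a map after the last one. Splitting off the first coordinate
  instead restarts the iteration at a random point, independent of the remaining coordinates, which is
  the Markov property used in \<open>integral_phi_iter\<close>.\<close>

lemma phi_iter_case_nat:
  "phi_iter L M (Suc n) x (case_nat s w) = phi_iter L M n (phi_map L M x s) w"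
  by (induction n) simp_all

text \<open>Boundedness of \<open>h\<close> makes Fubini applicable without moment estimates for the iterates.\<close>

lemma integral_phi_iter:
  fixes h :: "real \<Rightarrow> 'b::{banach, second_countable_topology}"
  assumes [measurable]: "h \<in> borel_measurable borel" and bound: "\<And>y. norm (h y) \<le> B"
  shows "(LINT w|S. h (phi_iter L M n x w)) = (mean_op ^^ n) h x"
proof (induction n arbitrary: x)
  case 0
  then show ?case by (simp add: seq.P.prob_space)
next
  case (Suc n)
  interpret PS: pair_prob_space P S ..
  have [measurable]: "(\<lambda>z. phi_iter L M n (phi_map L M x (fst z)) (snd z)) \<in> borel_measurable (P \<Otimes>\<^sub>M S)"
    using measurable_compose[of "\<lambda>z. (phi_map L M x (fst z), snd z)" "P \<Otimes>\<^sub>M S" "borel \<Otimes>\<^sub>M S", OF _ phi_iter_pair_measurable[of n]]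
    by (auto simp: phi_map_def)
  have [measurable]: "(\<lambda>(s, w). case_nat s w) \<in> measurable (P \<Otimes>\<^sub>M S) S"
    by measurable
  have "(LINT w|S. h (phi_iter L M (Suc n) x w))
      = (LINT w|distr (P \<Otimes>\<^sub>M S) S (\<lambda>(s, w). case_nat s w). h (phi_iter L M (Suc n) x w))"
    by (subst seq.PiM_iter) simp
  also have "\<dots> = (LINT z|(P \<Otimes>\<^sub>M S). h (phi_iter L M n (phi_map L M x (fst z)) (snd z)))"
    by (subst integral_distr) (auto simp: case_prod_beta phi_iter_case_nat simp del: phi_iter.simps)
  also have "\<dots> = (LINT s|P. LINT w|S. h (phi_iter L M n (phi_map L M x s) w))"
  proof (subst PS.integral_fst'[symmetric])
    show "integrable (P \<Otimes>\<^sub>M S) (\<lambda>z. h (phi_iter L M n (phi_map L M x (fst z)) (snd z)))"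
      using bound by (intro PS.P.integrable_const_bound[of _ B]) auto
  qed simp
  also have "\<dots> = (LINT s|P. (mean_op ^^ n) h (phi_map L M x s))"
    by (simp add: Suc.IH)
  also have "\<dots> = (mean_op ^^ Suc n) h x"
    by (simp add: mean_op_def)
  finally show ?case .
qed

lemma real_distribution_iter_law: "real_distribution (iter_law P L M n x)"
  unfolding iter_law_def by (intro seq.P.real_distribution_distr) auto

lemma integral_iter_law:
  fixes h :: "real \<Rightarrow> 'b::{banach, second_countable_topology}"
  assumes [measurable]: "h \<in> borel_measurable borel" and bound: "\<And>y. norm (h y) \<le> B"
  shows "(LINT y|iter_law P L M n x. h y) = (mean_op ^^ n) h x"
  unfolding iter_law_def
  by (subst integral_distr) (auto intro: integral_phi_iter bound)

text \<open>Markov's inequality with the truncated absolute value \<open>min \<bar>y\<bar> K\<close>: it is \<open>1\<close>-Lipschitz whatever \<open>K\<close>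
  is, so its means along the iterates are bounded by a number \<open>B\<close> independent of \<open>n\<close> and \<open>K\<close>.\<close>

lemma iterates_tight: "tight (\<lambda>n. iter_law P L M n x)"
  unfolding tight_def
proof (intro conjI allI impI)
  show "real_distribution (iter_law P L M n x)" for n
    by (rule real_distribution_iter_law)
  fix e :: real assume e: "0 < e"
  define B where "B = \<bar>x\<bar> + displacement x / (1 - rate)"
  have B: "0 \<le> B"
    using displacement_nonneg rate_less_1 by (simp add: B_def)
  (* The bound B / K for the mass outside of {-K<..K} has to be smaller than e,
     and K has to be positive even if B = 0. *)
  define K where "K = (B + 1) / e"
  have K: "0 < K" using B e by (simp add: K_def)
  define h :: "real \<Rightarrow> real" where "h y = min \<bar>y\<bar> K" for y
  have h_lip: "1-lipschitz_on UNIV h"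
    by (rule lipschitz_onI) (auto simp: h_def dist_real_def)
  have h_bound: "norm (h y) \<le> K" for y
    using K by (auto simp: h_def)
  note [measurable] = lipschitz_measurable[OF h_lip]
  have "1 - e < measure (iter_law P L M n x) {- K<..K}" for n
  proof -
    interpret Q: real_distribution "iter_law P L M n x"
      by (rule real_distribution_iter_law)
    have "(LINT y|iter_law P L M n x. h y) = (mean_op ^^ n) h x"
      by (rule integral_iter_law[OF _ h_bound]) measurable
    also have "\<dots> \<le> h x + norm ((mean_op ^^ (0 + n)) h x - (mean_op ^^ 0) h x)"
      by simp
    also have "\<dots> \<le> B"
      using mean_op_funpow_dist[OF h_lip, of 0 n x] by (simp add: B_def h_def)
    finally have mean_le: "(LINT y|iter_law P L M n x. h y) \<le> B" .
    have "Q.prob (- {- K<..K}) \<le> Q.prob {y \<in> space (iter_law P L M n x). K \<le> h y}"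
      by (intro Q.finite_measure_mono) (auto simp: h_def)
    also have "\<dots> \<le> (LINT y|iter_law P L M n x. h y) / K"
      using h_bound K
      by (intro integral_Markov_inequality_measure[where A = "{}"] Q.integrable_const_bound[of _ K])
         (auto simp: h_def)
    also have "\<dots> \<le> B / K"
      using mean_le K by (intro divide_right_mono) auto
    also have "\<dots> < e"
      using B e by (simp add: K_def field_simps)
    finally show ?thesis
      using Q.prob_compl[of "{- K<..K}"] by (simp add: Compl_eq_Diff_UNIV)
  qed
  then show "\<exists>a b. a < b \<and> (\<forall>n. 1 - e < measure (iter_law P L M n x) {a<..b})"
    using K by (intro exI[of _ "- K"] exI[of _ K]) auto
qed

lemma char_iter_law: "char (iter_law P L M n x) t = (mean_op ^^ n) (\<lambda>y. iexp (t * y)) x"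
  unfolding char_def by (rule integral_iter_law[where B = 1]) auto

text \<open>Tightness yields a limit \<open>\<mu>\<close> along a subsequence of the iterates of \<open>0\<close>. The characters are
  Lipschitz, so the characteristic functions converge along the whole sequence, with the same limit for
  every starting point; this limit must be the characteristic function of \<open>\<mu>\<close>.\<close>

lemma limit_law_exists:
  "\<exists>\<mu>. real_distribution \<mu> \<and> (\<forall>x. weak_conv_m (\<lambda>n. iter_law P L M n x) \<mu>)"
proof -
  obtain r \<mu> where r: "strict_mono (r :: nat \<Rightarrow> nat)" and \<mu>: "real_distribution \<mu>"
    and conv: "weak_conv_m ((\<lambda>n. iter_law P L M n 0) \<circ> id \<circ> r) \<mu>"
    using tight_imp_convergent_subsubsequence[OF iterates_tight strict_mono_id] by blast
  have "(\<lambda>n. char (iter_law P L M n x) t) \<longlonglongrightarrow> char \<mu> t" for x t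
  proof -
    obtain l where l: "\<And>x. (\<lambda>n. char (iter_law P L M n x) t) \<longlonglongrightarrow> l"
      using mean_op_funpow_convergent[OF iexp_lipschitz[of t]] by (auto simp: char_iter_law)
    have "(\<lambda>n. char (iter_law P L M (r n) 0) t) \<longlonglongrightarrow> char \<mu> t"
      using conv by (intro levy_continuity1 \<mu> real_distribution_iter_law) (simp add: o_def)
    then have "l = char \<mu> t"
      using LIMSEQ_subseq_LIMSEQ[OF l[of 0] r] by (simp add: o_def LIMSEQ_unique)
    with l show ?thesis by simp
  qed
  then have "weak_conv_m (\<lambda>n. iter_law P L M n x) \<mu>" for x
    by (intro levy_continuity \<mu> real_distribution_iter_law)
  with \<mu> show ?thesis by blast
qed

text \<open>The limit law is given by a definite description, so existence has to be complemented by
  uniqueness; weak convergence determines the characteristic function of the limit.\<close>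

lemma limit_law:
  "real_distribution (limit_law P L M)"
  "weak_conv_m (\<lambda>n. iter_law P L M n x) (limit_law P L M)"
proof -
  have unique: "\<mu> = \<nu>"
    if "real_distribution \<mu>" "real_distribution \<nu>"
      and "weak_conv_m (\<lambda>n. iter_law P L M n 0) \<mu>" "weak_conv_m (\<lambda>n. iter_law P L M n 0) \<nu>"
    for \<mu> \<nu>
  proof (intro Levy_uniqueness ext)
    show "char \<mu> t = char \<nu> t" for t
      using that by (meson LIMSEQ_unique levy_continuity1 real_distribution_iter_law)
  qed fact+
  have "real_distribution (limit_law P L M)
      \<and> (\<forall>x. weak_conv_m (\<lambda>n. iter_law P L M n x) (limit_law P L M))"
    unfolding limit_law_def
    by (rule theI') (use limit_law_exists unique in blast)
  then show "real_distribution (limit_law P L M)"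
    "weak_conv_m (\<lambda>n. iter_law P L M n x) (limit_law P L M)" by auto
qed

lemma mean_op_funpow_tendsto:
  fixes h :: "real \<Rightarrow> 'b::{banach, second_countable_topology}"
  assumes h: "C-lipschitz_on UNIV h" and bound: "\<And>y. norm (h y) \<le> B"
  shows "(\<lambda>n. (mean_op ^^ n) h x) \<longlonglongrightarrow> (LINT y|limit_law P L M. h y)"
proof -
  have "isCont h y" for y
    using lipschitz_on_continuous_on[OF h] by (simp add: continuous_on_eq_continuous_at)
  then have "(\<lambda>n. LINT y|iter_law P L M n x. h y) \<longlonglongrightarrow> (LINT y|limit_law P L M. h y)"
    using bound limit_law
    by (intro weak_conv_imp_integral_bdd_continuous_conv real_distribution_iter_law)
  then show ?thesis
    by (simp add: integral_iter_law[OF lipschitz_measurable[OF h] bound])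
qed

section \<open>The Poisson equation\<close>

text \<open>Centering makes the limit of \<open>T\<^sup>n h x\<close> equal to \<open>0\<close>, so \<open>T\<^sup>n h x\<close> decays geometrically and the
  Neumann series \<open>F\<close> converges pointwise. Its partial sums satisfy \<open>s\<^sub>n\<^sub>+\<^sub>1 = T s\<^sub>n + h\<close> and have a common
  Lipschitz constant, hence a common integrable bound of linear growth, and dominated convergence
  passes this recursion to the limit.\<close>

lemma poisson_equation:
  fixes h :: "real \<Rightarrow> 'b::{banach, second_countable_topology}"
  assumes h: "C-lipschitz_on UNIV h" and bound: "\<And>y. norm (h y) \<le> B"
    and centered: "(LINT y|limit_law P L M. h y) = 0"
  shows "\<exists>F. (C / (1 - rate))-lipschitz_on UNIV F \<and> (\<forall>x. F x = mean_op F x + h x)"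
proof -
  have C: "0 \<le> C" by (rule lipschitz_on_nonneg[OF h])
  define c where "c = C / (1 - rate)"
  have c: "0 \<le> c" using C rate_less_1 by (simp add: c_def)
  have term_le: "norm ((mean_op ^^ k) h x) \<le> rate ^ k * (c * displacement x)" for k x
    using mean_op_funpow_limit_dist[OF h mean_op_funpow_tendsto[OF h bound], of k x]
    by (simp add: centered c_def)
  define s where "s n x = (\<Sum>k<n. (mean_op ^^ k) h x)" for n x
  define F where "F x = (\<Sum>k. (mean_op ^^ k) h x)" for x
  have "summable (\<lambda>k. (mean_op ^^ k) h x)" for x
    using rate_nonneg rate_less_1
    by (intro summable_comparison_test'[OF _ term_le] summable_mult2 summable_geometric) auto
  then have s_tendsto: "(\<lambda>n. s n x) \<longlonglongrightarrow> F x" for x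
    unfolding s_def F_def by (rule summable_LIMSEQ)
  have s_lip: "c-lipschitz_on UNIV (s n)" for n
  proof (rule lipschitz_onI[OF _ c])
    fix x y
    have "dist (s n x) (s n y) \<le> (\<Sum>k<n. dist ((mean_op ^^ k) h x) ((mean_op ^^ k) h y))"
      by (simp add: s_def dist_norm flip: sum_subtractf) (rule norm_sum)
    also have "\<dots> \<le> (\<Sum>k<n. rate ^ k * (C * dist x y))"
      using lipschitz_onD[OF mean_op_funpow_lipschitz[OF h]]
      by (intro sum_mono) (simp add: mult.assoc)
    also have "\<dots> \<le> c * dist x y"
      using sum_rate_le[of "C * dist x y" n] C by (simp add: c_def)
    finally show "dist (s n x) (s n y) \<le> c * dist x y" .
  qed
  have F_lip: "c-lipschitz_on UNIV F"
  proof (rule lipschitz_onI[OF _ c])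
    fix x y
    show "dist (F x) (F y) \<le> c * dist x y"
      using lipschitz_onD[OF s_lip]
      by (intro tendsto_upperbound[OF tendsto_dist[OF s_tendsto s_tendsto]]) auto
  qed
  have "F x = mean_op F x + h x" for x
  proof (rule LIMSEQ_unique)
    show "(\<lambda>n. s (Suc n) x) \<longlonglongrightarrow> F x"
      by (rule LIMSEQ_Suc[OF s_tendsto])
    have "s (Suc n) x = mean_op (s n) x + h x" for n
    proof -
      have "mean_op (s n) x = (\<Sum>k<n. (mean_op ^^ Suc k) h x)"
        using lipschitz_comp_integrable[OF mean_op_funpow_lipschitz[OF h]]
        unfolding s_def mean_op_def[of "\<lambda>x. sum _ _"]
        by (simp add: mean_op_def)
      then show ?thesis
        by (simp only: s_def sum.lessThan_Suc_shift) simp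
    qed
    moreover have "(\<lambda>n. mean_op (s n) x) \<longlonglongrightarrow> mean_op F x"
      unfolding mean_op_def
    proof (rule integral_dominated_convergence)
      have s0: "norm (s n 0) \<le> c * displacement 0 / (1 - rate)" for n
      proof -
        have "norm (s n 0) \<le> (\<Sum>k<n. rate ^ k * (c * displacement 0))"
          unfolding s_def using term_le by (intro order_trans[OF norm_sum] sum_mono)
        also have "\<dots> \<le> c * displacement 0 / (1 - rate)"
          using c displacement_nonneg by (intro sum_rate_le) auto
        finally show ?thesis .
      qed
      show "integrable P (\<lambda>\<omega>. c * displacement 0 / (1 - rate) + c * \<bar>phi_map L M x \<omega>\<bar>)"
        using phi_map_integrable by auto
      show "AE \<omega> in P. norm (s n (phi_map L M x \<omega>))
          \<le> c * displacement 0 / (1 - rate) + c * \<bar>phi_map L M x \<omega>\<bar>" for n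
      proof (rule AE_I2)
        fix \<omega>
        have "norm (s n (phi_map L M x \<omega>)) \<le> norm (s n 0) + dist (s n (phi_map L M x \<omega>)) (s n 0)"
          unfolding dist_norm by (metis add.commute norm_triangle_sub)
        with s0[of n] lipschitz_onD[OF s_lip[of n], of "phi_map L M x \<omega>" 0]
        show "norm (s n (phi_map L M x \<omega>))
          \<le> c * displacement 0 / (1 - rate) + c * \<bar>phi_map L M x \<omega>\<bar>"
          by (simp add: dist_real_def)
      qed
      show "AE \<omega> in P. (\<lambda>n. s n (phi_map L M x \<omega>)) \<longlonglongrightarrow> F (phi_map L M x \<omega>)"
        using s_tendsto by simp
      show "(\<lambda>\<omega>. F (phi_map L M x \<omega>)) \<in> borel_measurable P"
        using lipschitz_comp_integrable[OF F_lip] by (rule borel_measurable_integrable)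
      show "(\<lambda>\<omega>. s n (phi_map L M x \<omega>)) \<in> borel_measurable P" for n
        using lipschitz_comp_integrable[OF s_lip] by (rule borel_measurable_integrable)
    qed
    ultimately show "(\<lambda>n. s (Suc n) x) \<longlonglongrightarrow> mean_op F x + h x"
      by (simp add: tendsto_intros)
  qed
  with F_lip show ?thesis unfolding c_def by blast
qed

end

section \<open>Primitives of integrable functions\<close>

text \<open>A Lebesgue measurable function composed with a measurable map need not be measurable, so every
  application of Fubini below goes through a Borel representative. The last property, with the
  indicator of a half-line as \<open>k\<close>, transfers primitives.\<close>

lemma lebesgue_borel_representative:
  fixes f :: "real \<Rightarrow> real"
  assumes f: "integrable lebesgue f"
  obtains f' where "f' \<in> borel_measurable borel" "AE x in lborel. f x = f' x"
    "integrable lborel f'"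
    "\<And>k. k \<in> borel_measurable borel \<Longrightarrow>
       (LINT x|lebesgue. k x * f x) = (LINT x|lborel. k x * f' x)"
proof -
  have meas_f [measurable]: "f \<in> borel_measurable lebesgue"
    using f by (rule borel_measurable_integrable)
  obtain f' where f' [measurable]: "f' \<in> borel_measurable lborel" and eq: "AE x in lborel. f x = f' x"
    using completion_ex_borel_measurable_real[OF meas_f] by blast
  have f'_borel: "f' \<in> borel_measurable borel" using f' by simp
  have eq': "AE x in lebesgue. f x = f' x" by (rule AE_completion[OF eq])
  have [measurable]: "f' \<in> borel_measurable lebesgue" by (rule measurable_completion[OF f'])
  have "integrable lebesgue f'"
    using f eq' by (subst integrable_cong_AE[symmetric, of f]) auto
  then have int: "integrable lborel f'"
    by (simp add: integrable_completion)
  have "(LINT x|lebesgue. k x * f x) = (LINT x|lborel. k x * f' x)"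
    if k: "k \<in> borel_measurable borel" for k :: "real \<Rightarrow> real"
  proof -
    have [measurable]: "k \<in> borel_measurable lebesgue"
      using k by (intro measurable_completion) simp
    have "(LINT x|lebesgue. k x * f x) = (LINT x|lebesgue. k x * f' x)"
      using eq' by (intro integral_cong_AE) auto
    also have "\<dots> = (LINT x|lborel. k x * f' x)"
      using k by (intro integral_completion) simp
    finally show ?thesis .
  qed
  with f'_borel eq int that show thesis by blast
qed

text \<open>Fubini for \<open>1\<^bsub>t < x\<^esub> g(t)\<close>. The strict inequality, which changes the integrand at the
  single point \<open>t = x\<close> only, makes the mass of \<open>{t<..}\<close> appear, which is \<open>1 - cdf t\<close> also at atoms.\<close>

lemma (in real_distribution) integral_primitive:
  assumes g: "integrable lebesgue g"
  shows "(LINT x|M. primitive g x) = (LINT t|lebesgue. g t) - (LINT t|lebesgue. g t * cdf M t)"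
proof -
  obtain g' where g' [measurable]: "g' \<in> borel_measurable borel" and int: "integrable lborel g'"
    and LINT_g: "\<And>k. k \<in> borel_measurable borel \<Longrightarrow>
       (LINT x|lebesgue. k x * g x) = (LINT x|lborel. k x * g' x)"
    using lebesgue_borel_representative[OF g] by metis
  have [measurable]: "cdf M \<in> borel_measurable borel"
    by (intro borel_measurable_mono) (auto simp: mono_def cdf_nondecreasing)
  interpret PS: pair_sigma_finite M lborel ..
  have prim: "primitive g x = (LINT t|lborel. (if t < x then g' t else 0))" for x
  proof -
    have "primitive g x = (LINT t|lborel. indicator {..x} t * g' t)"
      using LINT_g[of "indicator {..x}"] by (simp add: primitive_def set_lebesgue_integral_def)
    also have "\<dots> = (LINT t|lborel. (if t < x then g' t else 0))"
    proof (rule integral_cong_AE)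
      show "AE t in lborel. indicator {..x} t * g' t = (if t < x then g' t else 0)"
        using AE_lborel_singleton[of x] by eventually_elim (auto simp: indicator_def)
    qed auto
    finally show ?thesis .
  qed
  have tail: "(LINT x|M. (if t < x then g' t else 0)) = g' t - cdf M t * g' t" for t
  proof -
    have "(LINT x|M. (if t < x then g' t else 0)) = (LINT x|M. indicator {t<..} x * g' t)"
      by (intro Bochner_Integration.integral_cong) (auto simp: indicator_def)
    also have "\<dots> = prob (- {..t}) * g' t"
      by (simp add: Compl_atMost)
    also have "prob (- {..t}) = 1 - cdf M t"
      using prob_compl[of "{..t}"] by (simp add: cdf_def Compl_eq_Diff_UNIV)
    finally show ?thesis by (simp add: algebra_simps)
  qed
  have int_pair: "integrable (M \<Otimes>\<^sub>M lborel) (\<lambda>(x, t). (if t < x then g' t else 0))"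
  proof (rule Bochner_Integration.integrable_bound)
    show "integrable (M \<Otimes>\<^sub>M lborel) (\<lambda>(x, t). g' t)"
      using int by (intro PS.Fubini_integrable) auto
  qed auto
  have "(LINT x|M. primitive g x) = (LINT t|lborel. LINT x|M. (if t < x then g' t else 0))"
    unfolding prim by (rule PS.Fubini_integral[OF int_pair, symmetric])
  also have "\<dots> = (LINT t|lborel. g' t - cdf M t * g' t)"
    by (simp add: tail)
  also have "\<dots> = (LINT t|lborel. g' t) - (LINT t|lborel. cdf M t * g' t)"
  proof (rule Bochner_Integration.integral_diff[OF int])
    show "integrable lborel (\<lambda>t. cdf M t * g' t)"
      by (rule Bochner_Integration.integrable_bound[OF int])
        (auto simp: abs_mult cdf_nonneg cdf_bounded_prob intro!: mult_left_le_one_le)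
  qed
  also have "\<dots> = (LINT t|lebesgue. g t) - (LINT t|lebesgue. g t * cdf M t)"
    using LINT_g[of "\<lambda>_. 1"] LINT_g[of "cdf M"] by (simp add: mult.commute)
  finally show ?thesis .
qed

text \<open>The positive and the negative part of \<open>d\<close> are densities of finite measures that agree on all
  half-lines \<open>{x<..}\<close> and therefore coincide.\<close>

lemma AE_eq_0_if_primitive_eq_0:
  fixes d :: "real \<Rightarrow> real"
  assumes d: "integrable lborel d" and zero: "\<And>x. (LINT t|lborel. indicator {..x} t * d t) = 0"
  shows "AE t in lborel. d t = 0"
proof -
  have [measurable]: "d \<in> borel_measurable borel"
    using borel_measurable_integrable[OF d] by simp
  have int_ind: "integrable lborel (\<lambda>t. indicator A t * d t)" if "A \<in> sets borel" for A
    using integrable_real_mult_indicator[of A lborel d] d that by (simp add: mult.commute)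
  (* The hypothesis concerns left half-lines; letting x tend to infinity gives the total integral,
     and with it the integrals over right half-lines. *)
  have total: "(LINT t|lborel. d t) = 0"
  proof (rule tendsto_unique[OF trivial_limit_at_top_linorder])
    show "((\<lambda>x. LINT t|lborel. indicator {..x} t *\<^sub>R d t) \<longlongrightarrow> (LINT t|lborel. d t)) at_top"
      by (rule tendsto_integral_at_top) (auto intro: d)
  qed (simp add: zero)
  let ?p = "\<lambda>t. ennreal (d t)" and ?m = "\<lambda>t. ennreal (- d t)"
  have pos_int: "integrable lborel (\<lambda>t. indicator {x<..} t * max 0 (d t))"
    and neg_int: "integrable lborel (\<lambda>t. indicator {x<..} t * max 0 (- d t))" for x
    by (rule Bochner_Integration.integrable_bound[OF d]; auto simp: indicator_def)+
  have pos: "emeasure (density lborel ?p) {x<..} = ennreal (LINT t|lborel. indicator {x<..} t * max 0 (d t))" for x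
    using pos_int[of x]
    by (subst emeasure_density, measurable, subst nn_integral_eq_integral[symmetric])
       (auto intro!: nn_integral_cong simp: indicator_def max_def ennreal_neg)
  have neg: "emeasure (density lborel ?m) {x<..} = ennreal (LINT t|lborel. indicator {x<..} t * max 0 (- d t))" for x
    using neg_int[of x]
    by (subst emeasure_density, measurable, subst nn_integral_eq_integral[symmetric])
       (auto intro!: nn_integral_cong simp: indicator_def max_def ennreal_neg)
  have "density lborel ?p = density lborel ?m"
  proof (rule measure_eqI_lessThan)
    fix x :: real
    have "(LINT t|lborel. indicator {x<..} t * max 0 (d t)) - (LINT t|lborel. indicator {x<..} t * max 0 (- d t))
      = (LINT t|lborel. indicator {x<..} t * max 0 (d t) - indicator {x<..} t * max 0 (- d t))"
      using pos_int neg_int by simp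
    also have "\<dots> = (LINT t|lborel. d t - indicator {..x} t * d t)"
      by (intro Bochner_Integration.integral_cong) (auto simp: indicator_def)
    also have "\<dots> = 0"
      using d int_ind[of "{..x}"] by (simp add: total zero)
    finally show "emeasure (density lborel ?p) {x<..} = emeasure (density lborel ?m) {x<..}"
      by (simp add: pos neg)
  qed (auto simp: pos)
  then have "AE t in lborel. ?p t = ?m t"
    by (intro sigma_finite_measure.density_unique[OF sigma_finite_lborel]) auto
  then show ?thesis
  proof eventually_elim
    case (elim t)
    then show ?case
      by (cases "0 \<le> d t") (auto simp: ennreal_neg ennreal_eq_0_iff dest: sym)
  qed
qed

section \<open>Absolutely continuous solutions\<close>

lemma (in complete_measure) borel_measurable_AE_eq:
  assumes f: "f \<in> borel_measurable M" and eq: "AE x in M. f x = g x"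
  shows "g \<in> borel_measurable M"
proof (rule measurableI)
  fix A :: "'b set" assume A: "A \<in> sets borel"
  show "g -` A \<inter> space M \<in> sets M"
  proof (rule in_sets_AE)
    show "f -` A \<inter> space M \<in> sets M" using f A by (rule measurable_sets)
    show "AE x in M. x \<in> f -` A \<inter> space M \<longleftrightarrow> x \<in> g -` A \<inter> space M"
      using eq by eventually_elim auto
  qed simp
qed simp

text \<open>The argument runs with Borel representatives of \<open>f\<close> and \<open>g\<close>. The affine map \<open>t \<mapsto> L t - M\<close> with
  \<open>L > 0\<close> pulls null sets back to null sets, so for almost every \<open>t\<close> the representative agrees with
  \<open>f\<close> at \<open>L t - M\<close> for almost every \<open>\<omega>\<close>; completeness of \<open>P\<close> then makes the integrand with \<open>f\<close>
  measurable.\<close>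

lemma (in mean_contraction) derivative_in_V:
  assumes complete: "complete_measure P"
    and g: "integrable lebesgue g" and f: "integrable lebesgue f"
    and eq: "integrated_eq P L M (primitive g) (primitive f)"
  shows "f \<in> V P L M g"
proof -
  interpret complete_measure P by (rule complete)
  obtain f' where f' [measurable]: "f' \<in> borel_measurable borel" and f_f': "AE x in lborel. f x = f' x"
    and int_f': "integrable lborel f'"
    and LINT_f: "\<And>k. k \<in> borel_measurable borel \<Longrightarrow>
       (LINT x|lebesgue. k x * f x) = (LINT x|lborel. k x * f' x)"
    using lebesgue_borel_representative[OF f] by blast
  obtain g' where g' [measurable]: "g' \<in> borel_measurable borel" and g_g': "AE x in lborel. g x = g' x"
    and int_g': "integrable lborel g'"
    and LINT_g: "\<And>k. k \<in> borel_measurable borel \<Longrightarrow>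
       (LINT x|lebesgue. k x * g x) = (LINT x|lborel. k x * g' x)"
    using lebesgue_borel_representative[OF g] by blast
  have prim_f: "primitive f x = (LINT t|lborel. indicator {..x} t * f' t)" for x
    using LINT_f[of "indicator {..x}"] by (simp add: primitive_def set_lebesgue_integral_def)
  have prim_g: "primitive g x = (LINT t|lborel. indicator {..x} t * g' t)" for x
    using LINT_g[of "indicator {..x}"] by (simp add: primitive_def set_lebesgue_integral_def)
  have restrict: "integrable lborel (\<lambda>t. indicator {..x} t * h t)"
    if "integrable lborel h" for h :: "real \<Rightarrow> real" and x
    using integrable_real_mult_indicator[of "{..x}" lborel h] that by (simp add: mult.commute)
  interpret PS: pair_sigma_finite P lborel ..
  define k where "k \<omega> t = \<bar>L \<omega>\<bar> * f' (L \<omega> * t - M \<omega>)" for \<omega> t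
  have k_meas [measurable]: "(\<lambda>(\<omega>, t). k \<omega> t) \<in> borel_measurable (P \<Otimes>\<^sub>M lborel)"
    unfolding k_def by measurable
  have k_int: "integrable lborel (k \<omega>)" if "L \<omega> > 0" for \<omega>
    using lborel_integrable_real_affine[OF int_f', of "L \<omega>" "- M \<omega>"] that
    by (simp add: k_def[abs_def] algebra_simps)
  have k_norm: "(LINT t|lborel. norm (k \<omega> t)) = (LINT t|lborel. \<bar>f' t\<bar>)" if "L \<omega> > 0" for \<omega>
    using lborel_integral_real_affine[of "L \<omega>" "\<lambda>t. \<bar>f' t\<bar>" "- M \<omega>"] that
    by (simp add: k_def abs_mult algebra_simps)
  have k_prim: "(LINT t|lborel. indicator {..x} t * k \<omega> t) = primitive f (L \<omega> * x - M \<omega>)"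
    if "L \<omega> > 0" for \<omega> x
  proof -
    have "primitive f (L \<omega> * x - M \<omega>) = \<bar>L \<omega>\<bar> *
        (LINT t|lborel. indicator {..L \<omega> * x - M \<omega>} (- M \<omega> + L \<omega> * t) * f' (- M \<omega> + L \<omega> * t))"
      unfolding prim_f using that
      by (subst lborel_integral_real_affine[of "L \<omega>" _ "- M \<omega>"]) auto
    also have "\<dots> = (LINT t|lborel. indicator {..x} t * k \<omega> t)"
      unfolding integral_mult_right_zero[symmetric] using that
      by (intro Bochner_Integration.integral_cong)
        (auto simp: k_def indicator_def algebra_simps)
    finally show ?thesis by simp
  qed
  have k_pair: "integrable (P \<Otimes>\<^sub>M lborel) (\<lambda>(\<omega>, t). k \<omega> t)"
  proof (rule PS.Fubini_integrable)
    show "integrable P (\<lambda>\<omega>. LINT t|lborel. norm (case (\<omega>, t) of (\<omega>, t) \<Rightarrow> k \<omega> t))"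
    proof (rule integrable_cong_AE_imp)
      show "integrable P (\<lambda>_. LINT t|lborel. \<bar>f' t\<bar>)" by simp
      show "AE \<omega> in P. (LINT t|lborel. \<bar>f' t\<bar>) = (LINT t|lborel. norm (case (\<omega>, t) of (\<omega>, t) \<Rightarrow> k \<omega> t))"
        using L_pos by eventually_elim (simp only: split k_norm)
      show "(\<lambda>\<omega>. LINT t|lborel. norm (case (\<omega>, t) of (\<omega>, t) \<Rightarrow> k \<omega> t)) \<in> borel_measurable P"
        by measurable
    qed
    show "AE \<omega> in P. integrable lborel (\<lambda>t. case (\<omega>, t) of (\<omega>, t) \<Rightarrow> k \<omega> t)"
      using L_pos by eventually_elim (simp add: k_int)
  qed measurable
  (* Fubini replaces the mean of F (L x - M) by the primitive of K. *)
  define K where "K t = (LINT \<omega>|P. k \<omega> t)" for t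
  have K_int: "integrable lborel K"
    unfolding K_def by (rule PS.integrable_snd[OF k_pair])
  have K_prim: "(LINT t|lborel. indicator {..x} t * K t) = (LINT \<omega>|P. primitive f (L \<omega> * x - M \<omega>))" for x
  proof -
    have pair_x: "integrable (P \<Otimes>\<^sub>M lborel) (\<lambda>(\<omega>, t). indicator {..x} t * k \<omega> t)"
      by (rule Bochner_Integration.integrable_bound[OF k_pair]) (auto simp: indicator_def)
    have "(LINT t|lborel. indicator {..x} t * K t) = (LINT t|lborel. LINT \<omega>|P. indicator {..x} t * k \<omega> t)"
      by (simp add: K_def)
    also have "\<dots> = (LINT \<omega>|P. LINT t|lborel. indicator {..x} t * k \<omega> t)"
      by (rule PS.Fubini_integral[OF pair_x])
    also have "\<dots> = (LINT \<omega>|P. primitive f (L \<omega> * x - M \<omega>))"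
    proof (rule integral_cong_AE)
      show "AE \<omega> in P. (LINT t|lborel. indicator {..x} t * k \<omega> t) = primitive f (L \<omega> * x - M \<omega>)"
        using L_pos by eventually_elim (rule k_prim)
      show "(\<lambda>\<omega>. primitive f (L \<omega> * x - M \<omega>)) \<in> borel_measurable P"
        using eq unfolding integrated_eq_def by (blast intro: borel_measurable_integrable)
    qed measurable
    finally show ?thesis .
  qed
  have "AE t in lborel. f' t - K t - g' t = 0"
  proof (rule AE_eq_0_if_primitive_eq_0)
    show "integrable lborel (\<lambda>t. f' t - K t - g' t)"
      using int_f' K_int int_g' by auto
    fix x
    have "(LINT t|lborel. indicator {..x} t * (f' t - K t - g' t))
        = primitive f x - (LINT \<omega>|P. primitive f (L \<omega> * x - M \<omega>)) - primitive g x"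
      unfolding prim_f[of x] prim_g K_prim[symmetric]
      using restrict[OF int_f'] restrict[OF K_int] restrict[OF int_g']
      by (simp add: right_diff_distrib)
    also have "\<dots> = 0"
      using eq[unfolded integrated_eq_def, THEN spec, of x] by linarith
    finally show "(LINT t|lborel. indicator {..x} t * (f' t - K t - g' t)) = 0" .
  qed
  moreover have "AE t in lborel. integrable P (\<lambda>\<omega>. k \<omega> t)"
    by (rule PS.AE_integrable_snd[OF k_pair])
  moreover have "AE t in lborel. AE \<omega> in P. f (L \<omega> * t - M \<omega>) = f' (L \<omega> * t - M \<omega>)"
  proof -
    obtain N where N: "\<And>t. t \<notin> N \<Longrightarrow> f t = f' t" "N \<in> null_sets lborel"
      using AE_E3[OF f_f'] by force
    have [measurable]: "N \<in> sets borel"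
      using null_setsD2[OF N(2)] by simp
    have "AE t in lborel. t \<notin> N"
      using N(2) by (rule AE_not_in)
    have "AE \<omega> in P. AE t in lborel. L \<omega> * t - M \<omega> \<notin> N"
      using L_pos
    proof eventually_elim
      case (elim \<omega>)
      then show ?case
        using AE_borel_affine[of "L \<omega>" "\<lambda>t. t \<notin> N" "- M \<omega>"] \<open>AE t in lborel. t \<notin> N\<close>
        by simp
    qed
    moreover have "{z \<in> space (P \<Otimes>\<^sub>M lborel). L (fst z) * snd z - M (fst z) \<notin> N} \<in> sets (P \<Otimes>\<^sub>M lborel)"
      by measurable
    ultimately have "AE t in lborel. AE \<omega> in P. L \<omega> * t - M \<omega> \<notin> N"
      using PS.AE_commute[of "\<lambda>\<omega> t. L \<omega> * t - M \<omega> \<notin> N"] by blast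
    then show ?thesis
      by eventually_elim (use N(1) in \<open>auto elim!: eventually_mono\<close>)
  qed
  ultimately have "AE t in lborel. integrable P (\<lambda>\<omega>. \<bar>L \<omega>\<bar> * f (L \<omega> * t - M \<omega>)) \<and>
        f t = (LINT \<omega>|P. \<bar>L \<omega>\<bar> * f (L \<omega> * t - M \<omega>)) + g t"
    using f_f' g_g'
  proof eventually_elim
    case (elim t)
    have ae: "AE \<omega> in P. k \<omega> t = \<bar>L \<omega>\<bar> * f (L \<omega> * t - M \<omega>)"
      using elim(3) by eventually_elim (simp add: k_def)
    have meas: "(\<lambda>\<omega>. \<bar>L \<omega>\<bar> * f (L \<omega> * t - M \<omega>)) \<in> borel_measurable P"
      using borel_measurable_integrable[OF elim(2)] ae by (rule borel_measurable_AE_eq)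
    have "(LINT \<omega>|P. \<bar>L \<omega>\<bar> * f (L \<omega> * t - M \<omega>)) = K t"
      unfolding K_def using elim(2) meas ae by (intro integral_cong_AE) auto
    moreover have "integrable P (\<lambda>\<omega>. \<bar>L \<omega>\<bar> * f (L \<omega> * t - M \<omega>))"
      using elim(2) meas ae by (rule integrable_cong_AE_imp)
    ultimately show ?case using elim by simp
  qed
  then show ?thesis
    using f by (simp add: V_def AE_completion)
qed

section \<open>Existence of Lipschitz solutions and their derivatives\<close>

theorem theorem3p2:
  fixes P :: "'a measure" and L M :: "'a \<Rightarrow> real" and g :: "real \<Rightarrow> real"
  assumes "prob_space P" and "complete_measure P"
    and "L \<in> borel_measurable P" and "M \<in> borel_measurable P"
    and "AE \<omega> in P. L \<omega> > 0"
    and "integrable lebesgue g" and "\<not> (AE x in lebesgue. g x = 0)"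
    and "integrable P M"
    and "integrable P L" and "(LINT \<omega>|P. L \<omega>) < 1"
    and "complex_of_real (LINT t|lebesgue. g t * Phi P L M t) = fourier g 0"
    and "lipschitzian (primitive g)"
  shows "(\<exists>F. lipschitzian F \<and> integrated_eq P L M (primitive g) F) \<and>
    (\<forall>F f. lipschitzian F \<and> integrated_eq P L M (primitive g) F \<and>
       integrable lebesgue f \<and> (\<forall>x. F x = (LINT t:{..x}|lebesgue. f t))
       \<longrightarrow> f \<in> V P L M g)"
proof -
  interpret mean_contraction P L M
    using assms by (intro mean_contraction.intro mean_contraction_axioms.intro)
  interpret \<mu>: real_distribution "limit_law P L M" by (rule limit_law)
  from assms(12) obtain C where C: "C-lipschitz_on UNIV (primitive g)"
    by (auto simp: lipschitzian_def)
  have bound: "norm (primitive g x) \<le> (LINT t|lebesgue. \<bar>g t\<bar>)" for x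
  proof -
    have "norm (primitive g x) \<le> (LINT t|lebesgue. norm (indicator {..x} t *\<^sub>R g t))"
      unfolding primitive_def set_lebesgue_integral_def by (rule integral_norm_bound)
    also have "\<dots> \<le> (LINT t|lebesgue. \<bar>g t\<bar>)"
      using assms(6) by (intro integral_mono') (auto simp: indicator_def)
    finally show ?thesis .
  qed
  (* At frequency 0 the character in the Fourier integral is constantly 1. *)
  have "(LINT t|lebesgue. g t * cdf (limit_law P L M) t) = (LINT t|lebesgue. g t)"
    using assms(11) by (simp add: fourier_def Phi_def)
  then have "(LINT x|limit_law P L M. primitive g x) = 0"
    by (simp add: \<mu>.integral_primitive[OF assms(6)])
  then obtain F where F: "(C / (1 - rate))-lipschitz_on UNIV F"
    and eq: "\<And>x. F x = mean_op F x + primitive g x"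
    using poisson_equation[OF C bound] by blast
  have "lipschitzian F" using F by (auto simp: lipschitzian_def)
  moreover have "integrated_eq P L M (primitive g) F"
    unfolding integrated_eq_def
    using lipschitz_comp_integrable[OF F] eq[unfolded mean_op_def]
    unfolding phi_map_def by blast
  ultimately have "\<exists>F. lipschitzian F \<and> integrated_eq P L M (primitive g) F" by blast
  moreover have "f \<in> V P L M g"
    if "integrated_eq P L M (primitive g) F" "integrable lebesgue f"
      "\<And>x. F x = (LINT t:{..x}|lebesgue. f t)" for F f
  proof -
    have "F = primitive f" using that(3) by (auto simp: primitive_def)
    with that show ?thesis by (intro derivative_in_V assms) auto
  qed
  ultimately show ?thesis by blast
qed

end
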